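(* Let $\alpha,\beta,c,d>0$ and $l\ge 0$ be real constants with $l<\alpha<\frac{\beta(l+1)+l}{\beta+2}$. Let $u$ be any solution on $\mathbb{R}^+$ of $$\big(|u'|^{l}u'\big)'+c|u'|^{\alpha}u'+d|u|^{\beta}u=0,$$ and set $E(t)=\frac{l+1}{l+2}|u'(t)|^{l+2}+\frac{d}{\beta+2}|u(t)|^{\beta+2}$. Then the following alternative holds: either there is a positive constant $C$ such that $$\forall t\ge 1,\quad E(t)\le C\,t^{-\frac{l+2}{\alpha-l}},$$ or $$\limsup_{t\to\infty}t^{\frac{(\alpha+1)(\beta+2)}{\beta-\alpha}}E(t)>0.$$
   Context: $\mathbb{R}^+=[0,+\infty)$. A solution on $\mathbb{R}^+$ is a function $u\in\mathcal{C}^1(\mathbb{R}^+)$ with $|u'|^lu'\in\mathcal{C}^1(\mathbb{R}^+)$ which satisfies the equation at every point. *)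

theory Defs
  imports "HOL-Analysis.Analysis"
begin

text \<open>
  Functions on \<open>[0, +\<infinity>)\<close> are represented by total functions on the reals, of which only the
  values on \<open>{0..}\<close> matter: every derivative is taken within \<open>{0..}\<close>, hence is one-sided at 0.
\<close>

definition deriv_Rplus :: "(real \<Rightarrow> real) \<Rightarrow> real \<Rightarrow> real" where
  "deriv_Rplus f t = vector_derivative f (at t within {0..})"

text \<open>
  The library's \<open>C1_differentiable_on\<close> asks for two-sided derivatives, which at the end point 0
  would constrain the values outside \<open>{0..}\<close>.
\<close>

definition C1_Rplus :: "(real \<Rightarrow> real) \<Rightarrow> bool" where
  "C1_Rplus f \<longleftrightarrow> f differentiable_on {0..} \<and> continuous_on {0..} (deriv_Rplus f)"

text \<open>
  In the terms \<open>\<bar>x\<bar> powr p * x\<close> the convention \<open>0 powr 0 = 0\<close> is harmless, since the second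
  factor vanishes as well when \<open>x = 0\<close>.
\<close>

definition is_solution ::
  "real \<Rightarrow> real \<Rightarrow> real \<Rightarrow> real \<Rightarrow> real \<Rightarrow> (real \<Rightarrow> real) \<Rightarrow> bool" where
  "is_solution l \<alpha> \<beta> c d u \<longleftrightarrow>
     C1_Rplus u \<and>
     C1_Rplus (\<lambda>t. \<bar>deriv_Rplus u t\<bar> powr l * deriv_Rplus u t) \<and>
     (\<forall>t\<ge>0. deriv_Rplus (\<lambda>s. \<bar>deriv_Rplus u s\<bar> powr l * deriv_Rplus u s) t
              + c * \<bar>deriv_Rplus u t\<bar> powr \<alpha> * deriv_Rplus u t
              + d * \<bar>u t\<bar> powr \<beta> * u t = 0)"

definition energy :: "real \<Rightarrow> real \<Rightarrow> real \<Rightarrow> (real \<Rightarrow> real) \<Rightarrow> real \<Rightarrow> real" where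
  "energy l \<beta> d u t =
     (l + 1) / (l + 2) * \<bar>deriv_Rplus u t\<bar> powr (l + 2)
     + d / (\<beta> + 2) * \<bar>u t\<bar> powr (\<beta> + 2)"

end

theory Submission imports Defs begin

text \<open>
  Put \<open>p = (\<beta> + 1) / (\<alpha> + 1)\<close> and choose \<open>M\<close> with \<open>c * M powr (\<alpha> + 1) = 2 * d\<close>. The bound on
  \<open>\<alpha>\<close> gives \<open>p * (l + 2) > \<beta> + 2\<close>, so for small \<open>u\<close> the region \<open>u > 0\<close>, \<open>u' \<ge> - M * u powr p\<close> is
  forward invariant. A solution entering it, or its mirror image, satisfies
  \<open>\<bar>u\<bar> \<ge> A * t powr (- (1 / (p - 1)))\<close>, which makes the limit superior positive. If the limit superior
  vanishes, then \<open>u\<close> tends to 0 and hence finally \<open>M * \<bar>u\<bar> powr p \<le> \<bar>u'\<bar>\<close>: the damping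
  absorbs the restoring force, so \<open>(\<bar>u'\<bar> powr (l + 1))\<^sup>2\<close> satisfies a superlinear decay inequality.
  This yields the fast decay of \<open>u'\<close>, and integration from infinity yields that of \<open>u\<close>; the bound on
  \<open>\<alpha>\<close> is exactly what makes the potential energy decay at least as fast as the kinetic energy.
\<close>

section \<open>Comparison principles for scalar differential inequalities\<close>

text \<open>If \<open>f b\<close> were negative, \<open>f\<close> would vanish at the last time
  \<tau> of nonnegativity; the positive derivative there makes \<open>f\<close> positive just after
  \<tau>, a contradiction. The sign of \<open>f'\<close> is thus tested only on the boundary
  \<open>f t = 0\<close>.\<close>

lemma nonneg_barrier:
  fixes f f' :: "real \<Rightarrow> real"
  assumes "a \<le> b" and deriv: "\<And>t. t \<in> {a..b} \<Longrightarrow> (f has_real_derivative f' t) (at t)"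
    and "f a \<ge> 0" and pos: "\<And>t. t \<in> {a..b} \<Longrightarrow> f t = 0 \<Longrightarrow> f' t > 0"
  shows "f b \<ge> 0"
proof (rule ccontr)
  assume neg: "\<not> f b \<ge> 0"
  define S where "S = {t \<in> {a..b}. f t \<ge> 0}"
  have cont: "continuous_on {a..b} f"
    using deriv by (meson DERIV_isCont continuous_at_imp_continuous_on)
  have "closed S" unfolding S_def
    by (intro continuous_on_closed_Collect_le cont continuous_on_const closed_atLeastAtMost)
  then have "compact S"
    unfolding compact_eq_bounded_closed
    by (auto simp: S_def intro: bounded_subset[OF bounded_closed_interval[of a b]])
  moreover have "a \<in> S" using assms by (auto simp: S_def)
  ultimately obtain \<tau> where \<tau>: "\<tau> \<in> S" "\<And>t. t \<in> S \<Longrightarrow> t \<le> \<tau>"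
    using compact_attains_sup[of S] by blast
  have lt: "\<tau> < b" "a \<le> \<tau>" using \<tau>(1) neg by (auto simp: S_def less_le)
  \<comment> \<open>A zero between \<tau> and \<open>b\<close> belongs to \<open>S\<close>, so by
    maximality it is \<tau> itself.\<close>
  have "\<exists>x\<ge>\<tau>. x \<le> b \<and> f x = 0"
    using lt neg \<tau>(1) by (intro IVT2' continuous_on_subset[OF cont]) (auto simp: S_def)
  then have "f \<tau> = 0"
    using \<tau> lt by (auto simp: S_def) (metis order.trans order_antisym order_refl)
  then obtain \<delta> where \<delta>: "\<delta> > 0" "\<And>h. 0 < h \<Longrightarrow> h < \<delta> \<Longrightarrow> f \<tau> < f (\<tau> + h)"
    using DERIV_pos_inc_right[OF deriv pos] lt by (metis atLeastAtMost_iff less_eq_real_def)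
  define h where "h = min (\<delta> / 2) (b - \<tau>)"
  have "f (\<tau> + h) > 0" "\<tau> + h \<le> b" "h > 0"
    using \<delta> lt \<open>f \<tau> = 0\<close> by (auto simp: h_def)
  then show False using \<tau>(2)[of "\<tau> + h"] lt by (auto simp: S_def)
qed

text \<open>The substitution \<open>y powr (-\<gamma>)\<close> linearises
  \<open>y' = - k * y powr (1 + \<gamma>)\<close>: its slope is then exactly
  \<open>\<gamma> * k\<close>. An inequality for \<open>y'\<close> makes the difference from this
  linear function monotone.\<close>

lemma powr_neg_growth:
  fixes y y' :: "real \<Rightarrow> real"
  assumes "a \<le> b" and deriv: "\<And>t. t \<in> {a..b} \<Longrightarrow> (y has_real_derivative y' t) (at t)"
    and pos: "\<And>t. t \<in> {a..b} \<Longrightarrow> y t > 0" and "\<gamma> > 0"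
  shows powr_neg_growth_upper: "(\<And>t. t \<in> {a..b} \<Longrightarrow> y' t \<ge> - (k * y t powr (1 + \<gamma>))) \<Longrightarrow>
           y b powr (-\<gamma>) \<le> y a powr (-\<gamma>) + \<gamma> * k * (b - a)"
    and powr_neg_growth_lower: "(\<And>t. t \<in> {a..b} \<Longrightarrow> y' t \<le> - (k * y t powr (1 + \<gamma>))) \<Longrightarrow>
           y b powr (-\<gamma>) \<ge> y a powr (-\<gamma>) + \<gamma> * k * (b - a)"
proof -
  let ?g = "\<lambda>t. y t powr (-\<gamma>) - \<gamma> * k * t"
  have g': "(?g has_real_derivative - \<gamma> * y t powr (-\<gamma> - 1) * (y' t + k * y t powr (1 + \<gamma>))) (at t)"
    if t: "t \<in> {a..b}" for t
  proof -
    have "y t powr (-\<gamma> - 1) * y t powr (1 + \<gamma>) = 1"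
      using pos[OF t] by (simp add: powr_add[symmetric])
    then have "- \<gamma> * y t powr (-\<gamma> - 1) * (y' t + k * y t powr (1 + \<gamma>))
        = (-\<gamma>) * y t powr (-\<gamma> - 1) * y' t - \<gamma> * k"
      by (simp add: algebra_simps)
    moreover have "(?g has_real_derivative (-\<gamma>) * y t powr (-\<gamma> - 1) * y' t - \<gamma> * k) (at t)"
      using pos[OF t] deriv[OF t]
      by (auto intro!: derivative_eq_intros DERIV_fun_powr[THEN DERIV_cong])
    ultimately show ?thesis by simp
  qed
  { assume le: "\<And>t. t \<in> {a..b} \<Longrightarrow> y' t \<ge> - (k * y t powr (1 + \<gamma>))"
    have "?g b \<le> ?g a"
    proof (rule DERIV_nonpos_imp_nonincreasing[OF \<open>a \<le> b\<close>])
      fix t assume "a \<le> t" "t \<le> b"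
      then have t: "t \<in> {a..b}" by simp
      have "- \<gamma> * y t powr (-\<gamma> - 1) * (y' t + k * y t powr (1 + \<gamma>)) \<le> 0"
        using le[OF t] \<open>\<gamma> > 0\<close> by (intro mult_nonpos_nonneg) auto
      then show "\<exists>D. (?g has_real_derivative D) (at t) \<and> D \<le> 0" using g'[OF t] by blast
    qed
    then show "y b powr (-\<gamma>) \<le> y a powr (-\<gamma>) + \<gamma> * k * (b - a)"
      by (simp add: algebra_simps) }
  { assume le: "\<And>t. t \<in> {a..b} \<Longrightarrow> y' t \<le> - (k * y t powr (1 + \<gamma>))"
    have "?g a \<le> ?g b"
    proof (rule DERIV_nonneg_imp_nondecreasing[OF \<open>a \<le> b\<close>])
      fix t assume "a \<le> t" "t \<le> b"
      then have t: "t \<in> {a..b}" by simp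
      have "- \<gamma> * y t powr (-\<gamma> - 1) * (y' t + k * y t powr (1 + \<gamma>)) \<ge> 0"
        using le[OF t] \<open>\<gamma> > 0\<close> by (intro mult_nonpos_nonpos) auto
      then show "\<exists>D. (?g has_real_derivative D) (at t) \<and> 0 \<le> D" using g'[OF t] by blast
    qed
    then show "y b powr (-\<gamma>) \<ge> y a powr (-\<gamma>) + \<gamma> * k * (b - a)"
      by (simp add: algebra_simps) }
qed

lemma powr_neg_inverse_bounds:
  fixes x A \<gamma> :: real
  assumes "x > 0" "A > 0" "\<gamma> > 0"
  shows powr_neg_le_imp_ge: "x powr (-\<gamma>) \<le> A \<Longrightarrow> A powr (- (1 / \<gamma>)) \<le> x"
    and powr_neg_ge_imp_le: "x powr (-\<gamma>) \<ge> A \<Longrightarrow> x \<le> A powr (- (1 / \<gamma>))"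
proof -
  have x: "(x powr (-\<gamma>)) powr (- (1 / \<gamma>)) = x"
    using assms by (simp add: powr_powr)
  show "x powr (-\<gamma>) \<le> A \<Longrightarrow> A powr (- (1 / \<gamma>)) \<le> x"
    using powr_mono2'[of "- (1 / \<gamma>)" "x powr (-\<gamma>)" A] assms x by simp
  show "x powr (-\<gamma>) \<ge> A \<Longrightarrow> x \<le> A powr (- (1 / \<gamma>))"
    using powr_mono2'[of "- (1 / \<gamma>)" A "x powr (-\<gamma>)"] assms x by simp
qed

text \<open>The inequality makes \<open>y\<close> nonincreasing, so \<open>y t > 0\<close> gives
  positivity on all of \<open>{T..t}\<close>, where the substitution applies. The initial term is
  dropped as nonnegative, and \<open>t - T \<ge> t / 2\<close> absorbs the shift, so the bound does
  not involve \<open>y T\<close>.\<close>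

lemma superlinear_decay:
  fixes y y' :: "real \<Rightarrow> real"
  assumes "T > 0" "k > 0" "\<gamma> > 0"
    and deriv: "\<And>t. t \<ge> T \<Longrightarrow> (y has_real_derivative y' t) (at t)"
    and nonneg: "\<And>t. t \<ge> T \<Longrightarrow> y t \<ge> 0"
    and le: "\<And>t. t \<ge> T \<Longrightarrow> y' t \<le> - (k * y t powr (1 + \<gamma>))"
    and t: "t \<ge> 2 * T"
  shows "y t \<le> (\<gamma> * k / 2 * t) powr (- (1 / \<gamma>))"
proof (cases "y t = 0")
  case False
  then have y: "y t > 0" using nonneg[of t] t \<open>T > 0\<close> by simp
  have "y t \<le> y s" if "s \<in> {T..t}" for s
  proof (rule DERIV_nonpos_imp_nonincreasing[of s t y])
    show "s \<le> t" using that by simp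
    fix r assume "s \<le> r" "r \<le> t"
    then have r: "r \<ge> T" using that by simp
    have "y' r \<le> 0" using le[OF r] \<open>k > 0\<close> by (smt (verit) mult_nonneg_nonneg powr_ge_zero)
    then show "\<exists>D. (y has_real_derivative D) (at r) \<and> D \<le> 0" using deriv[OF r] by blast
  qed
  then have pos: "y s > 0" if "s \<in> {T..t}" for s using y that by force
  have "y T powr (-\<gamma>) + \<gamma> * k * (t - T) \<le> y t powr (-\<gamma>)"
    by (rule powr_neg_growth_lower[where y' = y']) (use assms pos in auto)
  moreover have "\<gamma> * k / 2 * t \<le> \<gamma> * k * (t - T)"
    using assms mult_left_mono[of "t / 2" "t - T" "\<gamma> * k"] by simp
  ultimately have "\<gamma> * k / 2 * t \<le> y t powr (-\<gamma>)"
    using powr_ge_zero[of "y T" "-\<gamma>"] by linarith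
  then show ?thesis using assms y by (intro powr_neg_ge_imp_le) auto
qed simp

text \<open>\<open>C / q * t powr (-q)\<close> is the integral of the bound on
  \<open>\<bar>v\<bar>\<close> from \<open>t\<close> to infinity. No integral is formed: the
  function minus this term is nondecreasing with limit 0, hence nonpositive; the same holds for
  \<open>- u\<close>.\<close>

lemma decay_of_deriv:
  fixes u v :: "real \<Rightarrow> real"
  assumes "T > 0" "q > 0"
    and deriv: "\<And>t. t \<ge> T \<Longrightarrow> (u has_real_derivative v t) (at t)"
    and v: "\<And>t. t \<ge> T \<Longrightarrow> \<bar>v t\<bar> \<le> C * t powr (- q - 1)"
    and u: "(u \<longlongrightarrow> 0) at_top" and t: "t \<ge> T"
  shows "\<bar>u t\<bar> \<le> C / q * t powr (-q)"
proof -
  have main: "f t \<le> C / q * t powr (-q)"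
    if deriv: "\<And>t. t \<ge> T \<Longrightarrow> (f has_real_derivative g t) (at t)"
      and g: "\<And>t. t \<ge> T \<Longrightarrow> \<bar>g t\<bar> \<le> C * t powr (- q - 1)"
      and f: "(f \<longlongrightarrow> 0) at_top" for f g :: "real \<Rightarrow> real"
  proof -
    let ?h = "\<lambda>t. f t - C / q * t powr (-q)"
    have mono: "?h t \<le> ?h s" if "s \<ge> t" for s
    proof (rule DERIV_nonneg_imp_nondecreasing[OF that])
      fix r assume "t \<le> r" "r \<le> s"
      then have r: "r \<ge> T" "r > 0" using t \<open>T > 0\<close> by auto
      have "(?h has_real_derivative g r + C * r powr (- q - 1)) (at r)"
        using r \<open>q > 0\<close> deriv[OF r(1)] by (auto intro!: derivative_eq_intros)
      moreover have "g r + C * r powr (- q - 1) \<ge> 0" using g[OF r(1)] by linarith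
      ultimately show "\<exists>D. (?h has_real_derivative D) (at r) \<and> 0 \<le> D" by blast
    qed
    have "eventually (\<lambda>s. ?h t \<le> ?h s) at_top"
      using eventually_ge_at_top[of t] by eventually_elim (rule mono)
    moreover have "(?h \<longlongrightarrow> 0 - C / q * 0) at_top"
      using \<open>q > 0\<close> by (intro tendsto_intros f tendsto_neg_powr filterlim_ident) auto
    ultimately have "?h t \<le> 0 - C / q * 0"
      by (intro tendsto_lowerbound[where f = ?h]) auto
    then show ?thesis by simp
  qed
  have "u t \<le> C / q * t powr (-q)" by (rule main[of u v]) (use assms in auto)
  moreover have "- u t \<le> C / q * t powr (-q)"
    by (rule main[of "\<lambda>t. - u t" "\<lambda>t. - v t"])
      (use assms tendsto_minus[OF u] in \<open>auto intro!: derivative_intros\<close>)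
  ultimately show ?thesis by linarith
qed

section \<open>Monotonicity of the signed power\<close>

lemma signed_powr_nonneg:
  fixes x l :: real
  shows "x \<ge> 0 \<Longrightarrow> \<bar>x\<bar> powr l * x = x powr (l + 1)"
  by (cases "x = 0") (auto simp: powr_add)

lemma signed_powr_less:
  fixes x y l :: real
  assumes "l \<ge> 0" "x < y"
  shows "\<bar>x\<bar> powr l * x < \<bar>y\<bar> powr l * y"
proof -
  consider "0 \<le> x" | "x < 0" "0 \<le> y" | "y < 0" by linarith
  then show ?thesis
  proof cases
    case 1
    then show ?thesis
      using assms powr_less_mono2[of "l + 1" x y] signed_powr_nonneg[of x l] signed_powr_nonneg[of y l] by simp
  next
    case 2
    then have "\<bar>x\<bar> powr l * x < 0" by (simp add: mult_pos_neg)
    moreover have "\<bar>y\<bar> powr l * y \<ge> 0" using 2 by simp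
    ultimately show ?thesis by linarith
  next
    case 3
    then show ?thesis
      using assms powr_less_mono2[of "l + 1" "-y" "-x"] signed_powr_nonneg[of "-x" l]
        signed_powr_nonneg[of "-y" l] by simp
  qed
qed

text \<open>This carries inequalities between \<open>\<bar>v\<bar> powr l * v\<close>, the quantity
  that the equation differentiates, and \<open>v\<close>, which need not be differentiable.\<close>

lemma signed_powr_le_iff:
  fixes x y l :: real
  assumes "l \<ge> 0"
  shows "\<bar>x\<bar> powr l * x \<le> \<bar>y\<bar> powr l * y \<longleftrightarrow> x \<le> y"
  using signed_powr_less[OF assms, of x y] signed_powr_less[OF assms, of y x]
  by (cases x y rule: linorder_cases) auto

section \<open>The equation as a first-order system, and its exponents\<close>

locale damped_oscillator =
  fixes l \<alpha> \<beta> c d :: real and u v :: "real \<Rightarrow> real"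
  assumes \<alpha>: "\<alpha> > 0" and \<beta>: "\<beta> > 0" and c: "c > 0" and d: "d > 0" and l: "l \<ge> 0"
    and l_less: "l < \<alpha>" and \<alpha>_less: "\<alpha> < (\<beta> * (l + 1) + l) / (\<beta> + 2)"
    and u': "\<And>t. t > 0 \<Longrightarrow> (u has_real_derivative v t) (at t)"
    and v': "\<And>t. t > 0 \<Longrightarrow> ((\<lambda>t. \<bar>v t\<bar> powr l * v t) has_real_derivative
               - c * \<bar>v t\<bar> powr \<alpha> * v t - d * \<bar>u t\<bar> powr \<beta> * u t) (at t)"
begin

text \<open>The equation is odd, so every statement about \<open>u > 0\<close> has a mirror image
  for \<open>u < 0\<close>.\<close>

lemma reflect: "damped_oscillator l \<alpha> \<beta> c d (\<lambda>t. - u t) (\<lambda>t. - v t)"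
proof
  fix t :: real assume "t > 0"
  then show "((\<lambda>t. - u t) has_real_derivative - v t) (at t)"
    by (intro derivative_intros u')
  show "((\<lambda>t. \<bar>- v t\<bar> powr l * - v t) has_real_derivative
     - c * \<bar>- v t\<bar> powr \<alpha> * - v t - d * \<bar>- u t\<bar> powr \<beta> * - u t) (at t)"
    using DERIV_minus[OF v'[OF \<open>t > 0\<close>]] by (simp add: add.commute)
qed (use \<alpha> \<beta> c d l l_less \<alpha>_less in auto)

lemma \<alpha>_mult_less: "\<alpha> * (\<beta> + 2) < \<beta> * (l + 1) + l"
  using \<alpha>_less \<beta> by (simp add: pos_less_divide_eq)

text \<open>With \<open>D = \<alpha> - l\<close> this says
  \<open>(1 / D - 1) * (\<beta> + 2) > (l + 2) / D\<close>, the comparison of potential and kinetic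
  decay rates.\<close>

lemma \<alpha>_minus_l_less: "(\<alpha> - l) * (\<beta> + 2) < \<beta> - l"
  using \<alpha>_mult_less by (simp add: algebra_simps)

lemma \<alpha>_less_\<beta>: "\<alpha> < \<beta>"
proof -
  have "(\<alpha> - l) * 1 \<le> (\<alpha> - l) * (\<beta> + 2)"
    using l_less \<beta> by (intro mult_left_mono) auto
  then show ?thesis using \<alpha>_minus_l_less by simp
qed

lemma \<alpha>_minus_l_less_1: "\<alpha> - l < 1"
  using \<alpha>_minus_l_less l \<beta> by (smt (verit) mult_le_cancel_right1)

section \<open>The trapping region and its forward invariance\<close>

text \<open>On a curve where \<open>\<bar>v\<bar>\<close> is of order
  \<open>\<bar>u\<bar> powr p\<close>, the damping and the restoring force have the same
  order.\<close>

definition p :: real where "p = (\<beta> + 1) / (\<alpha> + 1)"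

text \<open>On \<open>v = - (M * u powr p)\<close> the damping is twice the restoring force. The
  surplus pays for the motion of the curve in \<open>barrier\<close>, and leaves half of the damping
  in \<open>fast_deriv_bound\<close>.\<close>

definition M :: real where "M = (2 * d / c) powr (1 / (\<alpha> + 1))"

text \<open>The order in \<open>u\<close>, beyond \<open>\<beta> + 1\<close>, of the term caused by
  the motion of the boundary curve; its positivity makes that term negligible for small
  \<open>u\<close>.\<close>

definition \<kappa> :: real where "\<kappa> = p * (l + 2) - (\<beta> + 2)"

lemma p_gt_1: "p > 1" using \<alpha>_less_\<beta> \<alpha> by (simp add: p_def)

lemma p_mult: "p * (\<alpha> + 1) = \<beta> + 1" using \<alpha> by (simp add: p_def)

lemma p_minus_1: "p - 1 = (\<beta> - \<alpha>) / (\<alpha> + 1)" using \<alpha> by (simp add: p_def field_simps)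

lemma M_pos: "M > 0" using c d by (simp add: M_def)

lemma M_powr: "c * M powr (\<alpha> + 1) = 2 * d" using c d \<alpha> by (simp add: M_def powr_powr)

lemma \<kappa>_pos: "\<kappa> > 0"
  using \<alpha>_mult_less \<alpha> by (simp add: \<kappa>_def p_def field_simps)

lemma p_powr_\<alpha>:
  assumes "x \<ge> 0" shows "c * (M * x powr p) powr (\<alpha> + 1) = 2 * d * x powr (\<beta> + 1)"
  using assms M_pos M_powr by (simp add: powr_mult powr_powr p_mult)

text \<open>
  This smallness makes the region \<open>u > 0\<close>, \<open>v \<ge> - (M * u powr p)\<close> forward invariant: on its lower
  boundary \<open>(\<bar>v\<bar> powr l * v + M powr (l + 1) * u powr (p * (l + 1)))'\<close> equals \<open>u powr (\<beta> + 1)\<close> times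
  the difference of the two sides.
\<close>

definition small :: "real \<Rightarrow> bool" where
  "small x \<longleftrightarrow> M powr (l + 2) * (p * (l + 1)) * \<bar>x\<bar> powr \<kappa> < d"

lemma barrier:
  assumes "0 < a" "a \<le> b" and "\<And>t. t \<in> {a..b} \<Longrightarrow> u t > 0"
    and "\<And>t. t \<in> {a..b} \<Longrightarrow> small (u t)" and "v a \<ge> - (M * u a powr p)"
  shows "v b \<ge> - (M * u b powr p)"
proof -
  define s where "s = p * (l + 1)"
  have sp: "\<bar>- (M * x powr p)\<bar> powr l * (- (M * x powr p)) = - (M powr (l + 1) * x powr s)" for x
    using signed_powr_nonneg[of "M * x powr p" l] M_pos
    by (simp add: s_def powr_mult powr_powr)
  \<comment> \<open>\<open>?h\<close> has the same sign as \<open>v + M * u powr p\<close>, but is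
    differentiable by the equation.\<close>
  let ?h = "\<lambda>t. \<bar>v t\<bar> powr l * v t + M powr (l + 1) * u t powr s"
  let ?h' = "\<lambda>t. (- c * \<bar>v t\<bar> powr \<alpha> * v t - d * \<bar>u t\<bar> powr \<beta> * u t)
      + M powr (l + 1) * (s * u t powr (s - 1) * v t)"
  have iff: "?h t \<ge> 0 \<longleftrightarrow> v t \<ge> - (M * u t powr p)" for t
    using signed_powr_le_iff[OF l, of "- (M * u t powr p)" "v t"] sp[of "u t"] by linarith
  have iff0: "?h t \<le> 0 \<longleftrightarrow> v t \<le> - (M * u t powr p)" for t
    using signed_powr_le_iff[OF l, of "v t" "- (M * u t powr p)"] sp[of "u t"] by linarith
  have "?h b \<ge> 0"
  proof (rule nonneg_barrier[OF \<open>a \<le> b\<close>])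
    fix t assume t: "t \<in> {a..b}"
    then have t0: "t > 0" using \<open>0 < a\<close> by simp
    have ut: "u t > 0" using assms t by simp
    show "(?h has_real_derivative ?h' t) (at t)"
      using DERIV_add[OF v'[OF t0] DERIV_cmult[OF DERIV_fun_powr[OF u'[OF t0] ut, of s],
          of "M powr (l + 1)"]]
      by simp
    assume h0: "?h t = 0"
    then have vt: "v t = - (M * u t powr p)" using iff[of t] iff0[of t] by simp
    \<comment> \<open>In units of \<open>u powr (\<beta> + 1)\<close>, the damping contributes
      \<open>2 * d\<close> to \<open>?h' t\<close>, the restoring force \<open>- d\<close>, and the
      moving curve a term that \<open>small\<close> keeps above \<open>- d\<close>.\<close>
    have "c * (\<bar>v t\<bar> powr \<alpha> * v t) = - (2 * d * u t powr (\<beta> + 1))"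
      using signed_powr_nonneg[of "M * u t powr p" \<alpha>] p_powr_\<alpha>[of "u t"] ut M_pos
      unfolding vt by simp
    moreover have "\<bar>u t\<bar> powr \<beta> * u t = u t powr (\<beta> + 1)"
      using signed_powr_nonneg[of "u t" \<beta>] ut by simp
    moreover have "M powr (l + 1) * (s * u t powr (s - 1) * v t)
        = - (M powr (l + 2) * s * u t powr \<kappa>) * u t powr (\<beta> + 1)"
    proof -
      have "M powr (l + 2) = M powr (l + 1) * M"
        using M_pos powr_add[of M "l + 1" 1] by (simp add: add.commute add.left_commute)
      moreover have "u t powr (s - 1) * u t powr p = u t powr \<kappa> * u t powr (\<beta> + 1)"
        by (simp add: powr_add[symmetric] s_def \<kappa>_def algebra_simps)
      ultimately show ?thesis unfolding vt by (simp add: mult_ac)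
    qed
    ultimately have "?h' t = (d - M powr (l + 2) * s * u t powr \<kappa>) * u t powr (\<beta> + 1)"
      by (simp add: algebra_simps)
    moreover have "M powr (l + 2) * s * u t powr \<kappa> < d"
      using assms(4)[OF t] ut by (simp add: small_def s_def)
    ultimately show "?h' t > 0" using ut by simp
  qed (use iff assms in auto)
  then show ?thesis using iff by simp
qed

section \<open>Slow lower bound for trapped solutions\<close>

text \<open>By \<open>barrier\<close>, \<open>u' \<ge> - (M * u powr p)\<close> persists on the
  interval; comparison with exponent \<open>p = 1 + (p - 1)\<close> gives the bound.\<close>

lemma slow_bound_on:
  assumes "0 < a" "a \<le> b" and "\<And>t. t \<in> {a..b} \<Longrightarrow> u t > 0"
    and "\<And>t. t \<in> {a..b} \<Longrightarrow> small (u t)" and "v a \<ge> - (M * u a powr p)"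
  shows "u b \<ge> (u a powr (-(p - 1)) + (p - 1) * M * (b - a)) powr (- (1 / (p - 1)))"
proof -
  have "u b powr (-(p - 1)) \<le> u a powr (-(p - 1)) + (p - 1) * M * (b - a)"
  proof (rule powr_neg_growth_upper[OF \<open>a \<le> b\<close>])
    fix t assume t: "t \<in> {a..b}"
    then show "(u has_real_derivative v t) (at t)" using assms by (intro u') auto
    show "- (M * u t powr (1 + (p - 1))) \<le> v t"
      using barrier[of a t] assms t by simp
  qed (use assms p_gt_1 in auto)
  moreover have "u a > 0" "u b > 0" using assms(2) assms(3)[of a] assms(3)[of b] by auto
  moreover from this have "u a powr (-(p - 1)) + (p - 1) * M * (b - a) > 0"
    using assms(2) p_gt_1 M_pos by (intro add_pos_nonneg mult_nonneg_nonneg) auto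
  ultimately show ?thesis
    using p_gt_1 by (intro powr_neg_le_imp_ge) auto
qed

text \<open>Positivity after \<open>a\<close> is not assumed but bootstrapped: before a first zero
  the slow bound holds, and by continuity its positive value would bound \<open>u\<close> from below
  at that zero too.\<close>

lemma slow_if_trapped:
  assumes "0 < a" and small: "\<And>t. t \<ge> a \<Longrightarrow> small (u t)" and ua: "u a > 0"
    and va: "v a \<ge> - (M * u a powr p)"
  obtains A where "A > 0" "\<And>t. t \<ge> a \<Longrightarrow> u t \<ge> A * t powr (- (1 / (p - 1)))"
proof -
  let ?r = "\<lambda>t. (u a powr (-(p - 1)) + (p - 1) * M * (t - a)) powr (- (1 / (p - 1)))"
  have base: "u a powr (-(p - 1)) + (p - 1) * M * (t - a) > 0" if "t \<ge> a" for t
    using that ua p_gt_1 M_pos by (intro add_pos_nonneg) auto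
  have pos: "u t > 0" if "t \<ge> a" for t
  proof (rule ccontr)
    assume neg: "\<not> u t > 0"
    define S where "S = {s \<in> {a..t}. u s \<le> 0}"
    have cont: "continuous_on {a..t} u"
      using \<open>0 < a\<close> by (intro continuous_at_imp_continuous_on) (auto intro!: DERIV_isCont u')
    have "closed S" unfolding S_def
      by (intro continuous_on_closed_Collect_le cont continuous_on_const closed_atLeastAtMost)
    then have "compact S"
      unfolding compact_eq_bounded_closed
      by (auto simp: S_def intro: bounded_subset[OF bounded_closed_interval[of a t]])
    moreover have "t \<in> S" using that neg by (auto simp: S_def)
    ultimately obtain \<tau> where \<tau>: "\<tau> \<in> S" "\<And>t. t \<in> S \<Longrightarrow> \<tau> \<le> t"
      using compact_attains_inf[of S] by blast
    have "\<tau> > a" "\<tau> \<le> t" using \<tau>(1) ua by (auto simp: S_def less_le)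
    have lower: "u s \<ge> ?r s" if "s \<in> {a..<\<tau>}" for s
    proof (rule slow_bound_on)
      fix x assume "x \<in> {a..s}"
      then show "u x > 0" using \<tau>(2)[of x] that \<open>\<tau> \<le> t\<close> by (force simp: S_def)
    qed (use that small va \<open>0 < a\<close> in auto)
    have "eventually (\<lambda>s. s \<in> {a<..<\<tau>}) (at_left \<tau>)"
      using \<open>\<tau> > a\<close> by (intro eventually_at_leftI[of a]) auto
    then have "eventually (\<lambda>s. u s \<ge> ?r s) (at_left \<tau>)"
      by eventually_elim (use lower in auto)
    moreover have "(u \<longlongrightarrow> u \<tau>) (at_left \<tau>)"
      using DERIV_isCont[OF u', of \<tau>] \<open>\<tau> > a\<close> \<open>0 < a\<close>
      by (auto simp: isCont_def intro: filterlim_mono at_le)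
    moreover have "(?r \<longlongrightarrow> ?r \<tau>) (at_left \<tau>)"
      using base[of \<tau>] \<open>\<tau> > a\<close> by (intro tendsto_intros) auto
    ultimately have "?r \<tau> \<le> u \<tau>" by (intro tendsto_le[of "at_left \<tau>" u _ ?r]) auto
    moreover have "?r \<tau> > 0" using base[of \<tau>] \<open>\<tau> > a\<close> by simp
    moreover have "u \<tau> \<le> 0" using \<tau>(1) by (simp add: S_def)
    ultimately show False by linarith
  qed
  \<comment> \<open>As \<open>t / a \<ge> 1\<close>, the initial term is at most
    \<open>t / a\<close> times itself, so the whole base is at most \<open>B * t\<close>.\<close>
  define B where "B = u a powr (-(p - 1)) / a + (p - 1) * M"
  have B: "B > 0" using ua p_gt_1 M_pos \<open>0 < a\<close> by (auto simp: B_def intro!: add_pos_pos)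
  show thesis
  proof
    show "B powr (- (1 / (p - 1))) > 0" using B by simp
    fix t assume t: "t \<ge> a"
    have "u a powr (-(p - 1)) * 1 \<le> u a powr (-(p - 1)) * (t / a)"
      using t \<open>0 < a\<close> by (intro mult_left_mono) auto
    moreover have "(p - 1) * M * (t - a) \<le> (p - 1) * M * t"
      using p_gt_1 M_pos \<open>0 < a\<close> by (intro mult_left_mono) auto
    ultimately have "u a powr (-(p - 1)) + (p - 1) * M * (t - a) \<le> B * t"
      by (simp add: B_def algebra_simps)
    then have "(B * t) powr (- (1 / (p - 1))) \<le> ?r t"
      using base[OF t] p_gt_1 by (intro powr_mono2') auto
    also have "\<dots> \<le> u t"
      by (rule slow_bound_on) (use t pos small va \<open>0 < a\<close> in auto)
    finally show "B powr (- (1 / (p - 1))) * t powr (- (1 / (p - 1))) \<le> u t"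
      using B t \<open>0 < a\<close> by (simp add: powr_mult)
  qed
qed

section \<open>Fast decay of the velocity under dominant damping\<close>

lemma fast_deriv_bound:
  assumes "T > 0" and dom: "\<And>t. t \<ge> T \<Longrightarrow> M * \<bar>u t\<bar> powr p \<le> \<bar>v t\<bar>"
  obtains C where "C > 0" "\<And>t. t \<ge> 2 * T \<Longrightarrow> \<bar>v t\<bar> \<le> C * t powr (- (1 / (\<alpha> - l)))"
proof -
  \<comment> \<open>Solves \<open>2 * (l + 1) * (1 + \<gamma>) = (l + 1) + (\<alpha> + 1)\<close>,
    which turns the dissipation into the power \<open>1 + \<gamma>\<close> of
    \<open>(z t)\<^sup>2\<close>.\<close>
  define \<gamma> where "\<gamma> = (\<alpha> - l) / (2 * (l + 1))"
  have \<gamma>: "\<gamma> > 0" using l l_less by (simp add: \<gamma>_def)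
  define z where "z = (\<lambda>t. \<bar>v t\<bar> powr l * v t)"
  define z' where "z' = (\<lambda>t. - c * \<bar>v t\<bar> powr \<alpha> * v t - d * \<bar>u t\<bar> powr \<beta> * u t)"
  have abs_z: "\<bar>z t\<bar> = \<bar>v t\<bar> powr (l + 1)" for t
    using signed_powr_nonneg[of "\<bar>v t\<bar>" l] by (simp add: z_def abs_mult)
  have sq: "(z t)\<^sup>2 = \<bar>v t\<bar> powr (2 * (l + 1))" for t
  proof -
    have "(z t)\<^sup>2 = \<bar>z t\<bar> * \<bar>z t\<bar>" by (simp add: power2_eq_square)
    then show ?thesis by (simp add: abs_z powr_add[symmetric])
  qed
  have y: "(z t)\<^sup>2 \<le> (\<gamma> * c / 2 * t) powr (- (1 / \<gamma>))" if t: "t \<ge> 2 * T" for t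
  proof (rule superlinear_decay[OF \<open>T > 0\<close> c \<gamma> _ _ _ t, where y' = "\<lambda>t. 2 * (z t * z' t)"])
    fix t assume t: "t \<ge> T"
    then have t0: "t > 0" using \<open>T > 0\<close> by simp
    have "(z has_real_derivative z' t) (at t)" using v'[OF t0] by (simp add: z_def z'_def)
    then show "((\<lambda>t. (z t)\<^sup>2) has_real_derivative 2 * (z t * z' t)) (at t)"
      by (auto intro!: derivative_eq_intros)
    have v2: "z t * (\<bar>v t\<bar> powr \<alpha> * v t) = \<bar>v t\<bar> powr (l + 1) * \<bar>v t\<bar> powr (\<alpha> + 1)"
    proof -
      have "z t * (\<bar>v t\<bar> powr \<alpha> * v t) = (\<bar>v t\<bar> powr l * \<bar>v t\<bar>) * (\<bar>v t\<bar> powr \<alpha> * \<bar>v t\<bar>)"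
        by (simp add: z_def)
      also have "\<dots> = \<bar>v t\<bar> powr (l + 1) * \<bar>v t\<bar> powr (\<alpha> + 1)"
        using signed_powr_nonneg[of "\<bar>v t\<bar>" l] signed_powr_nonneg[of "\<bar>v t\<bar>" \<alpha>] by simp
      finally show ?thesis .
    qed
    \<comment> \<open>Raising \<open>dom\<close> to the power \<open>\<alpha> + 1\<close> bounds the
      restoring force by half of the damping.\<close>
    have "2 * (d * \<bar>u t\<bar> powr (\<beta> + 1)) \<le> c * \<bar>v t\<bar> powr (\<alpha> + 1)"
    proof -
      have "c * (M * \<bar>u t\<bar> powr p) powr (\<alpha> + 1) \<le> c * \<bar>v t\<bar> powr (\<alpha> + 1)"
        using dom[OF t] c M_pos \<alpha> by (intro mult_left_mono powr_mono2) auto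
      then show ?thesis using p_powr_\<alpha>[of "\<bar>u t\<bar>"] by simp
    qed
    then have "\<bar>z t\<bar> * (2 * (d * \<bar>u t\<bar> powr (\<beta> + 1))) \<le> \<bar>z t\<bar> * (c * \<bar>v t\<bar> powr (\<alpha> + 1))"
      by (rule mult_left_mono) simp
    moreover have "- (z t * (d * \<bar>u t\<bar> powr \<beta> * u t)) \<le> \<bar>z t\<bar> * (d * \<bar>u t\<bar> powr (\<beta> + 1))"
    proof -
      have "- (z t * (d * \<bar>u t\<bar> powr \<beta> * u t)) \<le> \<bar>z t * (d * \<bar>u t\<bar> powr \<beta> * u t)\<bar>" by simp
      also have "\<dots> = \<bar>z t\<bar> * (d * (\<bar>u t\<bar> powr \<beta> * \<bar>u t\<bar>))"
        using d by (simp add: abs_mult)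
      finally show ?thesis using signed_powr_nonneg[of "\<bar>u t\<bar>" \<beta>] by simp
    qed
    ultimately have "2 * (z t * z' t) \<le> - (c * (\<bar>v t\<bar> powr (l + 1) * \<bar>v t\<bar> powr (\<alpha> + 1)))"
      using v2 by (simp add: z'_def abs_z algebra_simps)
    also have "\<bar>v t\<bar> powr (l + 1) * \<bar>v t\<bar> powr (\<alpha> + 1) = ((z t)\<^sup>2) powr (1 + \<gamma>)"
    proof -
      have "2 * (l + 1) * (1 + \<gamma>) = (l + 1) + (\<alpha> + 1)" using l by (simp add: \<gamma>_def field_simps)
      then show ?thesis by (simp add: sq powr_powr powr_add[symmetric])
    qed
    finally show "2 * (z t * z' t) \<le> - (c * ((z t)\<^sup>2) powr (1 + \<gamma>))" .
  qed simp
  have e: "- (1 / \<gamma>) * (1 / (2 * (l + 1))) = - (1 / (\<alpha> - l))"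
    using l l_less by (simp add: \<gamma>_def field_simps)
  show thesis
  proof
    show "(\<gamma> * c / 2) powr (- (1 / (\<alpha> - l))) > 0" using \<gamma> c by simp
    fix t assume t: "t \<ge> 2 * T"
    have "\<bar>v t\<bar> = ((z t)\<^sup>2) powr (1 / (2 * (l + 1)))"
      using l by (simp add: sq powr_powr)
    also have "\<dots> \<le> ((\<gamma> * c / 2 * t) powr (- (1 / \<gamma>))) powr (1 / (2 * (l + 1)))"
      using y[OF t] l by (intro powr_mono2) auto
    also have "\<dots> = (\<gamma> * c / 2 * t) powr (- (1 / (\<alpha> - l)))"
      by (simp only: powr_powr e)
    finally show "\<bar>v t\<bar> \<le> (\<gamma> * c / 2) powr (- (1 / (\<alpha> - l))) * t powr (- (1 / (\<alpha> - l)))"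
      using \<gamma> c t \<open>T > 0\<close> by (simp only: powr_mult)
  qed
qed

section \<open>The energy dichotomy\<close>

definition E :: "real \<Rightarrow> real" where
  "E t = (l + 1) / (l + 2) * \<bar>v t\<bar> powr (l + 2) + d / (\<beta> + 2) * \<bar>u t\<bar> powr (\<beta> + 2)"

lemma E_ge: "d / (\<beta> + 2) * \<bar>u t\<bar> powr (\<beta> + 2) \<le> E t"
  using l by (simp add: E_def)

text \<open>The decay rate of \<open>\<bar>u\<bar> powr (\<beta> + 2)\<close> when \<open>u\<close>
  decays like \<open>t powr (- (1 / (p - 1)))\<close>; see \<open>K_eq\<close>.\<close>

definition K :: real where "K = (\<alpha> + 1) * (\<beta> + 2) / (\<beta> - \<alpha>)"

lemma K_pos: "K > 0" using \<alpha> \<beta> \<alpha>_less_\<beta> by (simp add: K_def)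

lemma K_eq: "1 / (p - 1) * (\<beta> + 2) = K" using \<alpha> \<alpha>_less_\<beta> by (simp add: K_def p_minus_1)

text \<open>For a trapped solution the slow bound keeps even the potential part of
  \<open>t powr K * E t\<close> above a positive constant.\<close>

lemma not_trapped:
  assumes lim: "((\<lambda>t. t powr K * E t) \<longlongrightarrow> 0) at_top"
    and "0 < a" and "\<And>t. t \<ge> a \<Longrightarrow> small (u t)" and "u a > 0"
  shows "v a < - (M * u a powr p)"
proof (rule ccontr)
  assume "\<not> ?thesis"
  then obtain A where A: "A > 0" "\<And>t. t \<ge> a \<Longrightarrow> u t \<ge> A * t powr (- (1 / (p - 1)))"
    using slow_if_trapped[of a] assms by auto
  have lower: "d / (\<beta> + 2) * A powr (\<beta> + 2) \<le> t powr K * E t" if t: "t \<ge> a" for t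
  proof -
    have t0: "t > 0" using t \<open>0 < a\<close> by simp
    have "A powr (\<beta> + 2) * t powr (-K) = (A * t powr (- (1 / (p - 1)))) powr (\<beta> + 2)"
      using A(1) K_eq by (simp add: powr_mult powr_powr)
    also have "\<dots> \<le> \<bar>u t\<bar> powr (\<beta> + 2)"
      using A \<beta> A(2)[OF t] by (intro powr_mono2) auto
    finally have "d / (\<beta> + 2) * (A powr (\<beta> + 2) * t powr (-K)) \<le> d / (\<beta> + 2) * \<bar>u t\<bar> powr (\<beta> + 2)"
      using d \<beta> by (intro mult_left_mono) auto
    also have "\<dots> \<le> E t" by (rule E_ge)
    finally have "t powr K * (d / (\<beta> + 2) * (A powr (\<beta> + 2) * t powr (-K))) \<le> t powr K * E t"
      by (intro mult_left_mono) auto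
    also have "t powr K * (d / (\<beta> + 2) * (A powr (\<beta> + 2) * t powr (-K)))
        = d / (\<beta> + 2) * A powr (\<beta> + 2)"
      using t0 by (simp add: powr_minus)
    finally show ?thesis .
  qed
  have "eventually (\<lambda>t. d / (\<beta> + 2) * A powr (\<beta> + 2) \<le> t powr K * E t) at_top"
    using eventually_ge_at_top[of a] by eventually_elim (rule lower)
  then have "d / (\<beta> + 2) * A powr (\<beta> + 2) \<le> 0"
    using lim by (intro tendsto_lowerbound[where F = at_top]) auto
  moreover have "d / (\<beta> + 2) * A powr (\<beta> + 2) > 0" using d \<beta> A by simp
  ultimately show False by simp
qed

lemma tendsto_u:
  assumes lim: "((\<lambda>t. t powr K * E t) \<longlongrightarrow> 0) at_top"
  shows "(u \<longlongrightarrow> 0) at_top"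
proof -
  have "((\<lambda>t. t powr (-K) * (t powr K * E t)) \<longlongrightarrow> 0 * 0) at_top"
    using K_pos by (intro tendsto_mult lim tendsto_neg_powr filterlim_ident) auto
  moreover have "eventually (\<lambda>t. t powr (-K) * (t powr K * E t) = E t) at_top"
    using eventually_gt_at_top[of 0]
    by eventually_elim (simp add: powr_add[symmetric] mult.assoc[symmetric])
  ultimately have "(E \<longlongrightarrow> 0) at_top" by (simp add: tendsto_cong)
  then have "((\<lambda>t. (\<beta> + 2) / d * E t) \<longlongrightarrow> (\<beta> + 2) / d * 0) at_top" by (intro tendsto_intros)
  then have lim: "((\<lambda>t. (\<beta> + 2) / d * E t) \<longlongrightarrow> 0) at_top" by simp
  have "\<bar>u t\<bar> powr (\<beta> + 2) \<le> (\<beta> + 2) / d * E t" for t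
    using E_ge[of t] d \<beta> by (simp add: field_simps)
  then have "((\<lambda>t. \<bar>u t\<bar> powr (\<beta> + 2)) \<longlongrightarrow> 0) at_top"
    by (intro tendsto_sandwich[OF _ _ tendsto_const lim] always_eventually) auto
  then have "((\<lambda>t. (\<bar>u t\<bar> powr (\<beta> + 2)) powr (1 / (\<beta> + 2))) \<longlongrightarrow> 0 powr (1 / (\<beta> + 2))) at_top"
    using \<beta> by (intro tendsto_powr') auto
  then show ?thesis using \<beta> by (simp add: powr_powr tendsto_rabs_zero_iff)
qed

lemma eventually_small:
  assumes "(u \<longlongrightarrow> 0) at_top"
  shows "eventually (\<lambda>t. small (u t)) at_top"
proof -
  have "((\<lambda>t. M powr (l + 2) * (p * (l + 1)) * \<bar>u t\<bar> powr \<kappa>)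
      \<longlongrightarrow> M powr (l + 2) * (p * (l + 1)) * (\<bar>0\<bar> powr \<kappa>)) at_top"
    using \<kappa>_pos assms by (intro tendsto_mult tendsto_const tendsto_powr' tendsto_rabs) auto
  then show ?thesis unfolding small_def using d by (intro order_tendstoD) auto
qed

text \<open>Once \<open>u\<close> is small, \<open>not_trapped\<close> applies to \<open>u\<close>
  or its reflection at every time with \<open>u t \<noteq> 0\<close>, so the damping dominates from
  then on.\<close>

lemma fast_decay:
  assumes lim: "((\<lambda>t. t powr K * E t) \<longlongrightarrow> 0) at_top"
  obtains C T where "C > 0" "T \<ge> 1" "\<And>t. t \<ge> T \<Longrightarrow> E t \<le> C * t powr (- ((l + 2) / (\<alpha> - l)))"
proof -
  interpret reflected: damped_oscillator l \<alpha> \<beta> c d "\<lambda>t. - u t" "\<lambda>t. - v t" by (rule reflect)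
  have E_reflected: "reflected.E = E" by (simp add: E_def reflected.E_def fun_eq_iff)
  obtain T\<^sub>0 where T\<^sub>0: "\<And>t. t \<ge> T\<^sub>0 \<Longrightarrow> small (u t)"
    using eventually_small[OF tendsto_u[OF lim]] by (auto simp: eventually_at_top_linorder)
  define T where "T = max 1 T\<^sub>0"
  have T: "T \<ge> 1" "\<And>t. t \<ge> T \<Longrightarrow> small (u t)" using T\<^sub>0 by (auto simp: T_def)
  have dom: "M * \<bar>u t\<bar> powr p \<le> \<bar>v t\<bar>" if t: "t \<ge> T" for t
  proof (cases "u t" "0::real" rule: linorder_cases)
    case less
    have "- v t < - (M * (- u t) powr p)"
      by (rule reflected.not_trapped) (use less t T lim E_reflected in \<open>auto simp: small_def\<close>)
    then show ?thesis using less by simp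
  next
    case equal
    then show ?thesis by simp
  next
    case greater
    have "v t < - (M * u t powr p)"
      by (rule not_trapped[OF lim]) (use greater t T in auto)
    then show ?thesis using greater by simp
  qed
  obtain C where C: "C > 0" "\<And>t. t \<ge> 2 * T \<Longrightarrow> \<bar>v t\<bar> \<le> C * t powr (- (1 / (\<alpha> - l)))"
    using fast_deriv_bound[of T] dom T by auto
  \<comment> \<open>Chosen so that \<open>- q - 1\<close> is the decay exponent of \<open>v\<close>;
    \<open>\<alpha> - l < 1\<close> makes it positive, as integration from infinity
    requires.\<close>
  define q where "q = 1 / (\<alpha> - l) - 1"
  have q: "q > 0" using \<alpha>_minus_l_less_1 l_less by (simp add: q_def)
  have u: "\<bar>u t\<bar> \<le> C / q * t powr (-q)" if "t \<ge> 2 * T" for t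
    by (rule decay_of_deriv[of "2 * T" q u v])
      (use T q C u' tendsto_u[OF lim] that in \<open>auto simp: q_def\<close>)
  have exponent: "(l + 2) / (\<alpha> - l) \<le> q * (\<beta> + 2)"
  proof -
    have "(1 / D - 1) * (\<beta> + 2) - (l + 2) / D = ((\<beta> - l) - D * (\<beta> + 2)) / D" if "D > 0" for D
      using that by (simp add: field_simps)
    from this[of "\<alpha> - l"]
    have "q * (\<beta> + 2) - (l + 2) / (\<alpha> - l) = ((\<beta> - l) - (\<alpha> - l) * (\<beta> + 2)) / (\<alpha> - l)"
      using l_less by (simp add: q_def)
    also have "\<dots> \<ge> 0" using \<alpha>_minus_l_less l_less by simp
    finally show ?thesis by simp
  qed
  show thesis
  proof
    let ?C = "(l + 1) / (l + 2) * C powr (l + 2) + d / (\<beta> + 2) * (C / q) powr (\<beta> + 2)"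
    show "?C > 0" using l d \<beta> C q by (intro add_pos_pos) auto
    show "2 * T \<ge> 1" using T by simp
    fix t assume t: "t \<ge> 2 * T"
    have "\<bar>v t\<bar> powr (l + 2) \<le> (C * t powr (- (1 / (\<alpha> - l)))) powr (l + 2)"
      using C(2)[OF t] l by (intro powr_mono2) auto
    also have "\<dots> = C powr (l + 2) * t powr (- ((l + 2) / (\<alpha> - l)))"
      using C by (simp add: powr_mult powr_powr)
    finally have v: "\<bar>v t\<bar> powr (l + 2) \<le> C powr (l + 2) * t powr (- ((l + 2) / (\<alpha> - l)))" .
    have "\<bar>u t\<bar> powr (\<beta> + 2) \<le> (C / q * t powr (-q)) powr (\<beta> + 2)"
      using u[OF t] \<beta> by (intro powr_mono2) auto
    also have "\<dots> = (C / q) powr (\<beta> + 2) * t powr (- (q * (\<beta> + 2)))"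
      using powr_mult[of "C / q" "t powr (-q)" "\<beta> + 2"] C q by (simp add: powr_powr)
    also have "\<dots> \<le> (C / q) powr (\<beta> + 2) * t powr (- ((l + 2) / (\<alpha> - l)))"
      using exponent t T by (intro mult_left_mono powr_mono) auto
    finally have u: "\<bar>u t\<bar> powr (\<beta> + 2) \<le> (C / q) powr (\<beta> + 2) * t powr (- ((l + 2) / (\<alpha> - l)))" .
    have "E t \<le> (l + 1) / (l + 2) * (C powr (l + 2) * t powr (- ((l + 2) / (\<alpha> - l))))
        + d / (\<beta> + 2) * ((C / q) powr (\<beta> + 2) * t powr (- ((l + 2) / (\<alpha> - l))))"
      unfolding E_def using v u l d \<beta> by (intro add_mono mult_left_mono) auto
    then show "E t \<le> ?C * t powr (- ((l + 2) / (\<alpha> - l)))" by (simp add: algebra_simps)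
  qed
qed

end

section \<open>From solutions on the half-line to the alternative\<close>

text \<open>A positive \<open>t\<close> is interior to \<open>{0..}\<close>, so the derivative
  within the half-line is two-sided.\<close>

lemma C1_RplusD:
  assumes "C1_Rplus f" "t > 0"
  shows "(f has_real_derivative deriv_Rplus f t) (at t)"
proof -
  have "f differentiable (at t within {0..})"
    using assms by (auto simp: C1_Rplus_def differentiable_on_def)
  then have "(f has_vector_derivative deriv_Rplus f t) (at t within {0..})"
    by (simp add: deriv_Rplus_def vector_derivative_works)
  moreover have "at t within {0..} = at t"
    using assms by (intro at_within_interior) (simp add: interior_real_atLeast)
  ultimately show ?thesis by (simp add: has_real_derivative_iff_has_vector_derivative)
qed

lemma is_solution_imp_damped_oscillator:
  assumes "\<alpha> > 0" "\<beta> > 0" "c > 0" "d > 0" "l \<ge> 0" "l < \<alpha>"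
    "\<alpha> < (\<beta> * (l + 1) + l) / (\<beta> + 2)" and sol: "is_solution l \<alpha> \<beta> c d u"
  shows "damped_oscillator l \<alpha> \<beta> c d u (deriv_Rplus u)"
proof
  fix t :: real assume t: "t > 0"
  show "(u has_real_derivative deriv_Rplus u t) (at t)"
    using C1_RplusD t sol by (simp add: is_solution_def)
  let ?z = "\<lambda>t. \<bar>deriv_Rplus u t\<bar> powr l * deriv_Rplus u t"
  have "deriv_Rplus ?z t = - c * \<bar>deriv_Rplus u t\<bar> powr \<alpha> * deriv_Rplus u t - d * \<bar>u t\<bar> powr \<beta> * u t"
    using sol t unfolding is_solution_def by (smt (verit) mult_minus_left)
  moreover have "(?z has_real_derivative deriv_Rplus ?z t) (at t)"
    using C1_RplusD t sol by (simp add: is_solution_def)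
  ultimately show "(?z has_real_derivative
      - c * \<bar>deriv_Rplus u t\<bar> powr \<alpha> * deriv_Rplus u t - d * \<bar>u t\<bar> powr \<beta> * u t) (at t)"
    by simp
qed (use assms in auto)

lemma continuous_on_energy:
  assumes "C1_Rplus u" "l \<ge> 0" "\<beta> > 0"
  shows "continuous_on {0..} (energy l \<beta> d u)"
proof -
  have "continuous_on {0..} u" "continuous_on {0..} (deriv_Rplus u)"
    using assms by (auto simp: C1_Rplus_def differentiable_imp_continuous_on)
  then show ?thesis
    unfolding energy_def using assms by (intro continuous_intros continuous_on_powr') auto
qed

theorem theorem5p1:
  fixes \<alpha> \<beta> c d l :: real and u :: "real \<Rightarrow> real"
  assumes "\<alpha> > 0" and "\<beta> > 0" and "c > 0" and "d > 0" and "l \<ge> 0"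
    and "l < \<alpha>" and "\<alpha> < (\<beta> * (l + 1) + l) / (\<beta> + 2)"
    and "is_solution l \<alpha> \<beta> c d u"
  shows "(\<exists>C>0. \<forall>t\<ge>1. energy l \<beta> d u t \<le> C * t powr (- ((l + 2) / (\<alpha> - l))))
    \<or> Limsup at_top
        (\<lambda>t. ereal (t powr ((\<alpha> + 1) * (\<beta> + 2) / (\<beta> - \<alpha>)) * energy l \<beta> d u t)) > 0"
proof -
  interpret damped_oscillator l \<alpha> \<beta> c d u "deriv_Rplus u"
    using assms by (rule is_solution_imp_damped_oscillator)
  have E: "energy l \<beta> d u = E" by (simp add: energy_def E_def fun_eq_iff)
  have E_nonneg: "E t \<ge> 0" for t using l d \<beta> by (simp add: E_def)
  let ?r = "(l + 2) / (\<alpha> - l)"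
  have "\<exists>C>0. \<forall>t\<ge>1. E t \<le> C * t powr (- ?r)"
    if "\<not> Limsup at_top (\<lambda>t. ereal (t powr K * E t)) > 0"
  proof -
    \<comment> \<open>The function is nonnegative, so a limit superior that is not positive forces
      convergence to 0.\<close>
    have "((\<lambda>t. t powr K * E t) \<longlongrightarrow> 0) at_top"
    proof (rule order_tendstoI)
      fix e :: real assume "e < 0"
      then show "eventually (\<lambda>t. e < t powr K * E t) at_top"
        using E_nonneg by (intro always_eventually) (smt (verit) mult_nonneg_nonneg powr_ge_zero)
    next
      fix e :: real assume "0 < e"
      then have "Limsup at_top (\<lambda>t. ereal (t powr K * E t)) < ereal e"
        using that by (metis ereal_less(2) not_le order_le_less_trans not_less)
      then have "eventually (\<lambda>t. ereal (t powr K * E t) < ereal e) at_top"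
        by (rule Limsup_lessD)
      then show "eventually (\<lambda>t. t powr K * E t < e) at_top" by simp
    qed
    then obtain C T where C: "C > 0" "T \<ge> 1" "\<And>t. t \<ge> T \<Longrightarrow> E t \<le> C * t powr (- ?r)"
      using fast_decay by blast
    \<comment> \<open>The fast bound starts only at \<open>T\<close>. On \<open>{1..T}\<close>
      continuity bounds \<open>E\<close> by some \<open>B\<close>, and
      \<open>t powr (- ?r) \<ge> T powr (- ?r)\<close> explains the extra constant
      \<open>B * T powr ?r\<close>.\<close>
    have "continuous_on {1..T} (\<lambda>t. E t)"
      using continuous_on_energy[of u l \<beta> d] assms unfolding E is_solution_def
      by (auto intro: continuous_on_subset)
    then have "compact (E ` {1..T})" by (intro compact_continuous_image) auto
    then obtain B where B: "\<And>t. t \<in> {1..T} \<Longrightarrow> E t \<le> B"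
      by (metis bounded_imp_bdd_above bdd_above.E compact_imp_bounded imageI)
    have "B \<ge> 0" using B[of 1] E_nonneg[of 1] C by simp
    have "E t \<le> (C + B * T powr ?r) * t powr (- ?r)" if t: "t \<ge> 1" for t
    proof (cases "t \<le> T")
      case True
      have "T powr ?r * t powr (- ?r) \<ge> T powr ?r * T powr (- ?r)"
        using True t l l_less by (intro mult_left_mono powr_mono2') auto
      then have "T powr ?r * t powr (- ?r) \<ge> 1" using C by (simp add: powr_add[symmetric])
      then have "B * 1 \<le> B * (T powr ?r * t powr (- ?r))"
        using \<open>B \<ge> 0\<close> by (intro mult_left_mono)
      moreover have "C * t powr (- ?r) \<ge> 0" using C by simp
      ultimately show ?thesis using B[of t] True t by (simp add: algebra_simps)
    next
      case False
      have "C * t powr (- ?r) \<le> (C + B * T powr ?r) * t powr (- ?r)"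
        using \<open>B \<ge> 0\<close> by (intro mult_right_mono) auto
      then show ?thesis using C(3)[of t] False by simp
    qed
    moreover have "C + B * T powr ?r > 0" using C \<open>B \<ge> 0\<close> by (simp add: add_pos_nonneg)
    ultimately show ?thesis by blast
  qed
  then show ?thesis unfolding E K_def by blast
qed

end
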